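(* Let $\Lambda$ be an at most countable index set, $Y$ a Hilbert space, $p\in(0,2)$, let $x^\dagger=(x^\dagger_\lambda)_{\lambda\in\Lambda}\in\ell^2(\Lambda)$ be sparse, and let $F\colon\ell^2(\Lambda)\to Y$ be bounded linear. Assume that one of the following conditions holds: - $p\in(1,2)$, there exists $\omega\in Y$ with $\partial\mathcal R_p(x^\dagger)=F^*\omega$, and $F$ is injective on $V=\{x\in\ell^2(\Lambda):\operatorname{supp}(x)\subset\operatorname{supp}(x^\dagger)\}$. - $p=1$, there exist $\xi=(\xi_\lambda)_{\lambda\in\Lambda}\in\partial\mathcal R_1(x^\dagger)$ and $\omega\in Y$ with $\xi=F^*\omega$, and $F$ is injective on $V=\{x\in\ell^2(\Lambda):\operatorname{supp}(x)\subset\{\lambda\in\Lambda:|\xi_\lambda|=1\}\}$. - $p\in(0,1)$, $x^\dagger$ is the unique $\mathcal R_p$-minimizing solution of $Fx=Fx^\dagger$, and $F$ is injective on $V=\{x\in\ell^2(\Lambda):\operatorname{supp}(x)\subset\operatorname{supp}(x^\dagger)\}$. Then \[ \sup\bigl\{\|x_\beta-x^\dagger\|_{\ell^2(\Lambda)}:x_\beta\in\Sigma(F,y,\beta),\ \|Fx^\dagger-y\|\le\beta\bigr\}=\mathcal O\bigl(\beta^{\min\{1,1/p\}}\bigr)\quad\text{as }\beta\to0, \] where the supremum is taken over all $y\in Y$ with $\|Fx^\dagger-y\|\le\beta$ and all $x_\beta\in\Sigma(F,y,\beta)$.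
   Context: $\ell^2(\Lambda)$ is the space of real square-summable families $x=(x_\lambda)_{\lambda\in\Lambda}$, and $\mathcal R_p(x):=\sum_{\lambda\in\Lambda}|x_\lambda|^p\in[0,+\infty]$ for $x\in\ell^2(\Lambda)$. The support is $\operatorname{supp}(x):=\{\lambda\in\Lambda:x_\lambda\ne0\}$, and $x$ is called sparse if $\operatorname{supp}(x)$ is finite. For $p\ge1$, $\partial\mathcal R_p(x^\dagger)\subset\ell^2(\Lambda)$ is the classical convex subdifferential of $\mathcal R_p$ as a functional on $\ell^2(\Lambda)$; for $p>1$ it is at most single valued and is identified with its single element. $F^*\colon Y\to\ell^2(\Lambda)$ is the adjoint of $F$. For $y\in Y$ and $\beta\ge0$, $\Sigma(F,y,\beta)$ denotes the set of solutions of \[ \mathcal R_p(x)\to\min\quad\text{subject to}\quad x\in\ell^2(\Lambda),\ \|Fx-y\|\le\beta, \] that is, the set of all feasible $x$ at which $\mathcal R_p$ attains its infimum over the feasible set. An $\mathcal R_p$-minimizing solution of $Fx=y$ is an element of $\Sigma(F,y,0)$. *)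

theory Defs
  imports "HOL-Analysis.Analysis" "HOL-Library.Landau_Symbols"
begin

section \<open>The space of real square-summable families\<close>

text \<open>The index set is the universe of the index type.\<close>

typedef 'i ell2 = "{x :: 'i \<Rightarrow> real. (\<lambda>i. (x i)\<^sup>2) summable_on UNIV}"
  morphisms coord Abs_ell2
  by (rule exI[of _ "\<lambda>_. 0"]) simp

setup_lifting type_definition_ell2

lemma square_summable_mult:
  fixes x y :: "'i \<Rightarrow> real"
  assumes "(\<lambda>i. (x i)\<^sup>2) summable_on UNIV" "(\<lambda>i. (y i)\<^sup>2) summable_on UNIV"
  shows "(\<lambda>i. x i * y i) summable_on UNIV"
proof -
  have bound: "norm (x i * y i) \<le> norm ((x i)\<^sup>2 + (y i)\<^sup>2)" for i
  proof -
    define a where "a = \<bar>x i\<bar> * \<bar>y i\<bar>"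
    have "2 * a \<le> (x i)\<^sup>2 + (y i)\<^sup>2"
      using sum_squares_bound[of "\<bar>x i\<bar>" "\<bar>y i\<bar>"] by (simp add: a_def mult.assoc)
    moreover have "0 \<le> a" by (simp add: a_def)
    ultimately have "a \<le> (x i)\<^sup>2 + (y i)\<^sup>2" by linarith
    then show ?thesis by (simp add: a_def abs_mult)
  qed
  have "(\<lambda>i. (x i)\<^sup>2 + (y i)\<^sup>2) summable_on UNIV"
    by (intro summable_on_add assms)
  then have "(\<lambda>i. norm ((x i)\<^sup>2 + (y i)\<^sup>2)) summable_on UNIV"
    by simp
  then have "(\<lambda>i. norm (x i * y i)) summable_on UNIV"
    by (rule Infinite_Sum.abs_summable_on_comparison_test) (rule bound)
  then show ?thesis
    by (rule abs_summable_summable)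
qed

lemma square_summable_add:
  fixes x y :: "'i \<Rightarrow> real"
  assumes "(\<lambda>i. (x i)\<^sup>2) summable_on UNIV" "(\<lambda>i. (y i)\<^sup>2) summable_on UNIV"
  shows "(\<lambda>i. (x i + y i)\<^sup>2) summable_on UNIV"
  unfolding power2_sum mult.assoc
  by (intro summable_on_add summable_on_cmult_right square_summable_mult assms)

instantiation ell2 :: (type) real_vector
begin

lift_definition zero_ell2 :: "'i ell2" is "\<lambda>_. 0" by simp

lift_definition plus_ell2 :: "'i ell2 \<Rightarrow> 'i ell2 \<Rightarrow> 'i ell2" is "\<lambda>x y i. x i + y i"
  by (rule square_summable_add)

lift_definition uminus_ell2 :: "'i ell2 \<Rightarrow> 'i ell2" is "\<lambda>x i. - x i" by simp

definition minus_ell2 :: "'i ell2 \<Rightarrow> 'i ell2 \<Rightarrow> 'i ell2" where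
  "minus_ell2 x y = x + - y"

lift_definition scaleR_ell2 :: "real \<Rightarrow> 'i ell2 \<Rightarrow> 'i ell2" is "\<lambda>r x i. r * x i"
  by (simp add: power_mult_distrib summable_on_cmult_right)

instance
  by standard (simp add: minus_ell2_def | transfer, simp add: algebra_simps fun_eq_iff)+

end

instantiation ell2 :: (type) real_inner
begin

definition inner_ell2 :: "'i ell2 \<Rightarrow> 'i ell2 \<Rightarrow> real" where
  "inner_ell2 x y = (\<Sum>\<^sub>\<infinity>i. coord x i * coord y i)"

definition norm_ell2 :: "'i ell2 \<Rightarrow> real" where
  "norm_ell2 x = sqrt (inner x x)"

definition sgn_ell2 :: "'i ell2 \<Rightarrow> 'i ell2" where
  "sgn_ell2 x = x /\<^sub>R norm x"

definition dist_ell2 :: "'i ell2 \<Rightarrow> 'i ell2 \<Rightarrow> real" where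
  "dist_ell2 x y = norm (x - y)"

definition uniformity_ell2 :: "('i ell2 \<times> 'i ell2) filter" where
  "uniformity_ell2 = (INF e\<in>{0<..}. principal {(x, y). dist x y < e})"

definition open_ell2 :: "'i ell2 set \<Rightarrow> bool" where
  "open_ell2 U \<longleftrightarrow> (\<forall>x\<in>U. \<forall>\<^sub>F (x', y) in uniformity. x' = x \<longrightarrow> y \<in> U)"

instance
proof
  fix x y z :: "'i ell2" and r :: real
  have sq: "(\<lambda>i. (coord u i)\<^sup>2) summable_on UNIV" for u :: "'i ell2"
    using coord[of u] by simp
  have mult: "(\<lambda>i. coord u i * coord v i) summable_on UNIV" for u v :: "'i ell2"
    by (rule square_summable_mult) (rule sq)+
  show "inner x y = inner y x"
    by (simp add: inner_ell2_def mult.commute)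
  show "inner (x + y) z = inner x z + inner y z"
    by (simp add: inner_ell2_def plus_ell2.rep_eq distrib_right infsum_add mult)
  show "inner (r *\<^sub>R x) y = r * inner x y"
    by (simp add: inner_ell2_def scaleR_ell2.rep_eq mult.assoc infsum_cmult_right')
  show "0 \<le> inner x x"
    by (simp add: inner_ell2_def infsum_nonneg)
  show "inner x x = 0 \<longleftrightarrow> x = 0"
  proof
    assume "inner x x = 0"
    then have le: "(\<Sum>\<^sub>\<infinity>i. coord x i * coord x i) \<le> 0"
      by (simp add: inner_ell2_def)
    have "coord x i * coord x i = 0" for i
      by (rule nonneg_infsum_le_0D[OF le mult]) simp_all
    then have "coord x = coord 0"
      by (simp add: zero_ell2.rep_eq fun_eq_iff)
    then show "x = 0"
      by (simp add: coord_inject)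
  qed (simp add: inner_ell2_def zero_ell2.rep_eq)
qed (rule norm_ell2_def sgn_ell2_def dist_ell2_def uniformity_ell2_def open_ell2_def)+

end


section \<open>Sparse regularization\<close>

definition supp :: "'i ell2 \<Rightarrow> 'i set" where
  "supp x = {i. coord x i \<noteq> 0}"

definition is_sparse :: "'i ell2 \<Rightarrow> bool" where
  "is_sparse x \<longleftrightarrow> finite (supp x)"

text \<open>In \<^typ>\<open>ereal\<close> the nonnegative sum always exists, with value \<open>\<infinity>\<close> when it diverges.\<close>

definition Reg :: "real \<Rightarrow> 'i ell2 \<Rightarrow> ereal" where
  "Reg p x = (\<Sum>\<^sub>\<infinity>i. ereal (\<bar>coord x i\<bar> powr p))"

text \<open>The convention is that the subdifferential is empty outside the effective domain.\<close>

definition subdifferential :: "('a::real_inner \<Rightarrow> ereal) \<Rightarrow> 'a \<Rightarrow> 'a set" where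
  "subdifferential f x =
     {\<xi>. \<bar>f x\<bar> \<noteq> \<infinity> \<and> (\<forall>z. f x + ereal (inner \<xi> (z - x)) \<le> f z)}"

definition Sol :: "real \<Rightarrow> ('i ell2 \<Rightarrow> 'y::real_normed_vector) \<Rightarrow> 'y \<Rightarrow> real \<Rightarrow> 'i ell2 set" where
  "Sol p F y \<beta> = {x. is_arg_min (Reg p) (\<lambda>x. norm (F x - y) \<le> \<beta>) x}"

text \<open>The supremum is taken in \<^typ>\<open>ennreal\<close>, so that it is meaningful (namely \<open>\<infinity>\<close>) before
  boundedness is known.\<close>

definition worst_case_error ::
    "real \<Rightarrow> ('i ell2 \<Rightarrow> 'y::real_normed_vector) \<Rightarrow> 'i ell2 \<Rightarrow> real \<Rightarrow> ennreal" where
  "worst_case_error p F xd \<beta> =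
     Sup {ennreal (norm (x - xd)) | x y. x \<in> Sol p F y \<beta> \<and> norm (F xd - y) \<le> \<beta>}"

end

(*
  A minimizer x satisfies R_p(x) <= R_p(xd) and |F(x - xd)| <= 2 beta. Since F is bounded below on
  the finitely supported vectors over T, it is enough to control the part of x off T.

  If p >= 1, test the subgradient inequality with z = x restricted to T: the sum of |x_i|^p off T
  is at most R_p(xd) - R_p(z) <= -<xi, z - xd>, and xi = F* omega makes this O(beta) up to a term
  which the bound |xi_i| <= m < 1 off T absorbs; T is the set |xi_i| = 1 for p = 1 and the support
  of xd for p > 1. An l^p bound on a sequence bounds its l^2 norm, which costs the exponent 1/p.

  If p < 1, weak compactness and uniqueness give x -> xd uniformly in the coordinates. Near zero
  |t|^p dominates any multiple N |t|, whereas R_p decreases at most linearly on the support, so the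
  part of x off the support is at most a small multiple of |x - xd| and is absorbed.
*)
theory Submission
  imports Defs
begin

section \<open>Coordinates and norm of square-summable families\<close>

lemma square_summable_coord: "(\<lambda>i. (coord x i)\<^sup>2) summable_on UNIV"
  using coord[of x] by simp

lemma coord_mult_summable: "(\<lambda>i. coord x i * coord y i) summable_on UNIV"
  by (rule square_summable_mult; rule square_summable_coord)

lemma coord_Abs_ell2:
  "(\<lambda>i. (f i)\<^sup>2) summable_on UNIV \<Longrightarrow> coord (Abs_ell2 f) = f"
  by (simp add: Abs_ell2_inverse)

lemma ell2_eqI: "(\<And>i. coord x i = coord y i) \<Longrightarrow> x = y"
  by (metis coord_inject ext)

lemma coord_add [simp]: "coord (x + y) i = coord x i + coord y i"
  by (simp add: plus_ell2.rep_eq)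

lemma coord_zero [simp]: "coord 0 i = 0"
  by (simp add: zero_ell2.rep_eq)

lemma coord_diff [simp]: "coord (x - y) i = coord x i - coord y i"
  unfolding minus_ell2_def by (simp only: plus_ell2.rep_eq uminus_ell2.rep_eq diff_conv_add_uminus)

lemma coord_scaleR [simp]: "coord (r *\<^sub>R x) i = r * coord x i"
  by (simp add: scaleR_ell2.rep_eq)

lemma coord_sum [simp]: "coord (sum f A) i = (\<Sum>a\<in>A. coord (f a) i)"
  by (induction A rule: infinite_finite_induct) auto

lemma norm_ell2_sq: "(norm x)\<^sup>2 = (\<Sum>\<^sub>\<infinity>i. (coord x i)\<^sup>2)"
  unfolding power2_norm_eq_inner inner_ell2_def by (simp add: power2_eq_square)

lemma sum_coord_sq_le:
  assumes "finite A"
  shows "(\<Sum>i\<in>A. (coord x i)\<^sup>2) \<le> (norm x)\<^sup>2"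
  unfolding norm_ell2_sq
  by (rule finite_sum_le_infsum[OF square_summable_coord assms]) auto

lemma norm_ell2_leI:
  assumes "\<And>A. finite A \<Longrightarrow> (\<Sum>i\<in>A. (coord x i)\<^sup>2) \<le> M\<^sup>2" and "0 \<le> M"
  shows "norm x \<le> M"
proof -
  have "(norm x)\<^sup>2 \<le> M\<^sup>2"
    unfolding norm_ell2_sq
    by (rule infsum_le_finite_sums[OF square_summable_coord]) (use assms(1) in auto)
  then show ?thesis
    using assms(2) by (rule power2_le_imp_le)
qed

lemma abs_coord_le_norm: "\<bar>coord x i\<bar> \<le> norm x"
  using sum_coord_sq_le[of "{i}" x] abs_le_square_iff[of "coord x i" "norm x"] by simp

section \<open>Restriction to index sets and density of finitely supported vectors\<close>

lift_definition restr :: "'i set \<Rightarrow> 'i ell2 \<Rightarrow> 'i ell2" is "\<lambda>A x i. if i \<in> A then x i else 0"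
proof -
  fix A :: "'i set" and x :: "'i \<Rightarrow> real"
  assume x: "(\<lambda>i. (x i)\<^sup>2) summable_on UNIV"
  show "(\<lambda>i. (if i \<in> A then x i else 0)\<^sup>2) summable_on UNIV"
    by (rule summable_on_comparison_test[OF x]) auto
qed

lemma coord_restr: "coord (restr A x) i = (if i \<in> A then coord x i else 0)"
  by (simp add: restr.rep_eq)

lemma supp_restr: "supp (restr A x) \<subseteq> A"
  by (auto simp: supp_def coord_restr split: if_splits)

lemma restr_add_restr_Compl: "restr A x + restr (- A) x = x"
  by (rule ell2_eqI) (auto simp: coord_restr)

lemma inner_finite_supp:
  assumes "finite A" "supp x \<subseteq> A"
  shows "inner x y = (\<Sum>i\<in>A. coord x i * coord y i)"
proof -
  have "inner x y = (\<Sum>\<^sub>\<infinity>i\<in>A. coord x i * coord y i)"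
    unfolding inner_ell2_def
    by (rule infsum_cong_neutral) (use assms in \<open>auto simp: supp_def\<close>)
  then show ?thesis
    using assms by simp
qed

lemma norm_finite_supp:
  assumes "finite A" "supp x \<subseteq> A"
  shows "(norm x)\<^sup>2 = (\<Sum>i\<in>A. (coord x i)\<^sup>2)"
  unfolding power2_norm_eq_inner inner_finite_supp[OF assms] by (simp add: power2_eq_square)

text \<open>The restriction is orthogonal to the remainder, so the squared distance is the squared
  norm minus a partial sum of it, which tends to 0.\<close>

lemma tendsto_restr:
  "((\<lambda>A. restr A x) \<longlongrightarrow> x) (finite_subsets_at_top UNIV)"
proof -
  have eq: "(norm (restr A x - x))\<^sup>2 = (norm x)\<^sup>2 - (\<Sum>i\<in>A. (coord x i)\<^sup>2)" if "finite A" for A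
  proof -
    have "(norm (restr A x - x))\<^sup>2 = (norm x)\<^sup>2 - 2 * inner (restr A x) x + (norm (restr A x))\<^sup>2"
      by (simp add: power2_norm_eq_inner algebra_simps inner_commute)
    then show ?thesis
      unfolding inner_finite_supp[OF that supp_restr] norm_finite_supp[OF that supp_restr]
      by (simp add: coord_restr power2_eq_square)
  qed
  have "((\<lambda>A. (norm x)\<^sup>2 - (\<Sum>i\<in>A. (coord x i)\<^sup>2)) \<longlongrightarrow> (norm x)\<^sup>2 - (norm x)\<^sup>2)
          (finite_subsets_at_top UNIV)"
    unfolding norm_ell2_sq
    by (intro tendsto_diff tendsto_const infsum_tendsto square_summable_coord)
  then have "((\<lambda>A. (norm (restr A x - x))\<^sup>2) \<longlongrightarrow> (norm x)\<^sup>2 - (norm x)\<^sup>2)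
          (finite_subsets_at_top UNIV)"
    by (rule Lim_transform_eventually)
       (rule eventually_finite_subsets_at_top_weakI, rule eq[symmetric])
  then have "((\<lambda>A. sqrt ((norm (restr A x - x))\<^sup>2)) \<longlongrightarrow> sqrt ((norm x)\<^sup>2 - (norm x)\<^sup>2))
          (finite_subsets_at_top UNIV)"
    by (rule tendsto_real_sqrt)
  then have "((\<lambda>A. norm (restr A x - x)) \<longlongrightarrow> 0) (finite_subsets_at_top UNIV)"
    by simp
  then show ?thesis
    by (subst Lim_null) (rule tendsto_norm_zero_cancel)
qed

lift_definition unit_vec :: "'i \<Rightarrow> 'i ell2" is "\<lambda>j i. of_bool (i = j)"
proof -
  fix j :: 'i
  have "(\<lambda>i. (of_bool (i = j) :: real)\<^sup>2) summable_on {j}"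
    by simp
  then show "(\<lambda>i. (of_bool (i = j) :: real)\<^sup>2) summable_on UNIV"
    by (rule summable_on_cong_neutral[THEN iffD1, rotated -1]) auto
qed

lemma coord_unit_vec [simp]: "coord (unit_vec j) i = of_bool (i = j)"
  by (simp add: unit_vec.rep_eq)

lemma finite_supp_expand:
  assumes "finite A" "supp x \<subseteq> A"
  shows "x = (\<Sum>i\<in>A. coord x i *\<^sub>R unit_vec i)"
proof (rule ell2_eqI)
  fix j
  have "(\<Sum>i\<in>A. coord x i * of_bool (j = i)) = (\<Sum>i\<in>A. if i = j then coord x j else 0)"
    by (rule sum.cong) auto
  then show "coord x j = coord (\<Sum>i\<in>A. coord x i *\<^sub>R unit_vec i) j"
    using assms by (auto simp: supp_def)
qed

section \<open>Linear maps on finitely supported vectors and the adjoint\<close>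

lemma linear_finite_supp:
  assumes "linear F" "finite A" "supp x \<subseteq> A"
  shows "F x = (\<Sum>i\<in>A. coord x i *\<^sub>R F (unit_vec i))"
proof -
  have "F x = F (\<Sum>i\<in>A. coord x i *\<^sub>R unit_vec i)"
    using finite_supp_expand[OF assms(2,3)] by (rule arg_cong)
  then show ?thesis
    by (simp add: linear_sum[OF assms(1)] linear_scale[OF assms(1)])
qed

text \<open>The library only knows that adjoints exist between Euclidean spaces.\<close>

lemma ell2_adjoint:
  fixes F :: "'i ell2 \<Rightarrow> 'y::real_inner"
  assumes F: "bounded_linear F"
  shows "inner (F x) \<omega> = inner x (adjoint F \<omega>)"
proof -
  note lin = bounded_linear.linear[OF F]
  \<comment> \<open>The only candidate for the coordinates of the adjoint at
    \<open>\<omega>\<close>: its inner products with the unit vectors are prescribed.\<close>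
  define a where "a \<omega> i = inner (F (unit_vec i)) \<omega>" for \<omega> i
  obtain K where K: "K \<ge> 0" "\<And>x. norm (F x) \<le> norm x * K"
    using bounded_linear.nonneg_bounded[OF F] by blast
  have bound: "(\<Sum>i\<in>A. (a \<omega> i)\<^sup>2) \<le> (K * norm \<omega>)\<^sup>2" if A: "finite A" for A \<omega>
  proof -
    \<comment> \<open>Testing with the coefficients \<open>a \<omega>\<close> themselves makes
      \<open>inner (F u) \<omega>\<close> and the squared norm of \<open>u\<close> both equal to
      \<open>s\<close>, so boundedness of \<open>F\<close> lets one factor \<open>sqrt s\<close>
      cancel.\<close>
    define u where "u = (\<Sum>i\<in>A. a \<omega> i *\<^sub>R unit_vec i)"
    define s where "s = (\<Sum>i\<in>A. (a \<omega> i)\<^sup>2)"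
    have s0: "s \<ge> 0"
      unfolding s_def by (intro sum_nonneg) auto
    have cu: "coord u j = (if j \<in> A then a \<omega> j else 0)" for j
    proof -
      have "(\<Sum>i\<in>A. a \<omega> i * of_bool (j = i)) = (\<Sum>i\<in>A. if i = j then a \<omega> j else 0)"
        by (rule sum.cong) auto
      then show ?thesis
        using A by (simp add: u_def)
    qed
    have "s = inner (F u) \<omega>"
      unfolding u_def s_def
      by (simp add: linear_sum[OF lin] linear_scale[OF lin] inner_sum_left a_def power2_eq_square)
    also have "\<dots> \<le> norm (F u) * norm \<omega>"
      by (rule norm_cauchy_schwarz)
    also have "\<dots> \<le> norm u * (K * norm \<omega>)"
      using K(2)[of u] by (simp add: mult_right_mono flip: mult.assoc)
    also have "norm u = sqrt s"
    proof -
      have "(norm u)\<^sup>2 = s"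
        using norm_finite_supp[of A u] A by (simp add: supp_def cu subset_iff s_def)
      then show ?thesis
        by (simp add: real_sqrt_unique)
    qed
    finally have *: "sqrt s * sqrt s \<le> sqrt s * (K * norm \<omega>)"
      using s0 by simp
    have "sqrt s \<le> K * norm \<omega>"
    proof (cases "s = 0")
      case True
      then show ?thesis using K(1) by simp
    next
      case False
      then have "sqrt s > 0" using s0 by simp
      then show ?thesis using * by (metis mult_le_cancel_left_pos)
    qed
    then have "(sqrt s)\<^sup>2 \<le> (K * norm \<omega>)\<^sup>2"
      using s0 by (intro power_mono) auto
    then show ?thesis
      using s0 by (simp add: s_def)
  qed
  have summ: "(\<lambda>i. (a \<omega> i)\<^sup>2) summable_on UNIV" for \<omega>
    by (rule nonneg_bounded_partial_sums_imp_summable_on[where C = "(K * norm \<omega>)\<^sup>2"])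
       (use bound in \<open>auto intro!: eventually_finite_subsets_at_top_weakI\<close>)
  define G where "G \<omega> = Abs_ell2 (a \<omega>)" for \<omega>
  have cG: "coord (G \<omega>) = a \<omega>" for \<omega>
    unfolding G_def by (rule coord_Abs_ell2) (rule summ)
  \<comment> \<open>Both sides are continuous in \<open>x\<close> and agree on finite restrictions,
    hence agree in the limit.\<close>
  have FG: "inner (F x) \<omega> = inner x (G \<omega>)" for x \<omega>
  proof (rule tendsto_unique[OF finite_subsets_at_top_neq_bot])
    show "((\<lambda>A. inner (F (restr A x)) \<omega>) \<longlongrightarrow> inner (F x) \<omega>) (finite_subsets_at_top UNIV)"
      by (intro tendsto_inner tendsto_const bounded_linear.tendsto[OF F] tendsto_restr)
    have eq: "inner (F (restr A x)) \<omega> = inner (restr A x) (G \<omega>)" if "finite A" for A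
      by (simp add: inner_finite_supp[OF that supp_restr] linear_finite_supp[OF lin that supp_restr]
          inner_sum_left cG a_def)
    have "((\<lambda>A. inner (restr A x) (G \<omega>)) \<longlongrightarrow> inner x (G \<omega>)) (finite_subsets_at_top UNIV)"
      by (intro tendsto_inner tendsto_const tendsto_restr)
    then show "((\<lambda>A. inner (F (restr A x)) \<omega>) \<longlongrightarrow> inner x (G \<omega>)) (finite_subsets_at_top UNIV)"
      by (rule Lim_transform_eventually)
         (rule eventually_finite_subsets_at_top_weakI, rule eq[symmetric])
  qed
  \<comment> \<open>\<open>adjoint\<close> is defined by choice, so \<open>G\<close> is identified
    with it through uniqueness of adjoints.\<close>
  then have "adjoint F = G"
    by (intro adjoint_unique) auto
  with FG show ?thesis
    by simp
qed

section \<open>The regularizer through finite sums, and the embedding of \<open>l^p\<close> into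
  \<open>l^2\<close>\<close>

text \<open>A nonnegative sum in \<open>ereal\<close> is the supremum of its finite partial sums.
  Later estimates can therefore stay with finite sums of reals.\<close>

lemma Reg_le_iff:
  "Reg p x \<le> ereal C \<longleftrightarrow> (\<forall>A. finite A \<longrightarrow> (\<Sum>i\<in>A. \<bar>coord x i\<bar> powr p) \<le> C)"
proof -
  have "Reg p x = (SUP A\<in>{A. finite A \<and> A \<subseteq> UNIV}. \<Sum>i\<in>A. ereal (\<bar>coord x i\<bar> powr p))"
    unfolding Reg_def by (rule nonneg_infsum_complete) auto
  then show ?thesis
    by (simp add: SUP_le_iff)
qed

lemma Reg_finite_supp:
  assumes "finite A" "supp x \<subseteq> A"
  shows "Reg p x = ereal (\<Sum>i\<in>A. \<bar>coord x i\<bar> powr p)"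
proof -
  have "Reg p x = (\<Sum>\<^sub>\<infinity>i\<in>A. ereal (\<bar>coord x i\<bar> powr p))"
    unfolding Reg_def by (rule infsum_cong_neutral) (use assms in \<open>auto simp: supp_def\<close>)
  then show ?thesis
    using assms by simp
qed

text \<open>Each coordinate is at most \<open>M = C powr (1 / p)\<close> in modulus, so its square
  is at most \<open>M powr (2 - p)\<close> times its \<open>p\<close>-th power; summation gives the
  square of \<open>M\<close>. The exponent \<open>1 / p\<close> of the rate originates here.\<close>

lemma norm_le_of_powr_sums:
  assumes p: "0 < p" "p \<le> 2"
    and C: "\<And>A. finite A \<Longrightarrow> (\<Sum>i\<in>A. \<bar>coord x i\<bar> powr p) \<le> C"
  shows "norm x \<le> C powr (1 / p)"
proof (rule norm_ell2_leI)
  define M where "M = C powr (1 / p)"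
  have C0: "0 \<le> C"
    using C[of "{}"] by simp
  have M0: "0 \<le> M"
    by (simp add: M_def)
  have Mp: "M powr p = C"
    using p C0 by (simp add: M_def powr_powr)
  have coord_le: "\<bar>coord x i\<bar> \<le> M" for i
  proof -
    have "\<bar>coord x i\<bar> powr p \<le> M powr p"
      using C[of "{i}"] by (simp add: Mp)
    then show ?thesis
      using p(1) M0 by (meson abs_ge_zero not_le powr_less_mono2)
  qed
  fix A :: "'a set" assume A: "finite A"
  have "(\<Sum>i\<in>A. (coord x i)\<^sup>2) \<le> (\<Sum>i\<in>A. \<bar>coord x i\<bar> powr p * M powr (2 - p))"
  proof (rule sum_mono)
    fix i
    have "(coord x i)\<^sup>2 = \<bar>coord x i\<bar> powr p * \<bar>coord x i\<bar> powr (2 - p)"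
      by (cases "coord x i = 0") (simp_all flip: powr_add)
    also have "\<dots> \<le> \<bar>coord x i\<bar> powr p * M powr (2 - p)"
      using coord_le[of i] p by (intro mult_left_mono powr_mono2) auto
    finally show "(coord x i)\<^sup>2 \<le> \<bar>coord x i\<bar> powr p * M powr (2 - p)" .
  qed
  also have "\<dots> \<le> C * M powr (2 - p)"
    unfolding sum_distrib_right[symmetric] by (intro mult_right_mono C A) auto
  also have "\<dots> = M powr p * M powr (2 - p)"
    by (simp add: Mp)
  also have "\<dots> = M\<^sup>2"
    using M0 by (cases "M = 0") (simp_all flip: powr_add)
  finally show "(\<Sum>i\<in>A. (coord x i)\<^sup>2) \<le> (C powr (1 / p))\<^sup>2"
    by (simp add: M_def)
qed simp

section \<open>Compactness, weak convergence and stability of a unique minimizer\<close>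

text \<open>Tychonoff's theorem for a product of intervals; the topology is that of coordinatewise
  convergence.\<close>

lemma compact_box: "compact {f :: 'i \<Rightarrow> real. \<forall>i. \<bar>f i\<bar> \<le> M}"
proof -
  have "compactin (product_topology (\<lambda>_ :: 'i. euclidean :: real topology) UNIV)
          (PiE UNIV (\<lambda>_. {- M..M}))"
    unfolding compactin_PiE by simp
  moreover have "PiE UNIV (\<lambda>_ :: 'i. {- M..M}) = {f. \<forall>i. \<bar>f i\<bar> \<le> M}"
    by (auto simp: PiE_def extensional_def abs_le_iff minus_le_iff)
  ultimately show ?thesis
    by (simp add: euclidean_product_topology)
qed

text \<open>On the finite-dimensional space of vectors supported in a nonempty \<open>T\<close>, the
  norm of the image attains a positive minimum over the unit sphere; \<open>c\<close> is its
  reciprocal.\<close>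

lemma inj_finite_supp_lower_bound:
  fixes F :: "'i ell2 \<Rightarrow> 'y::real_normed_vector"
  assumes lin: "linear F" and T: "finite T" and inj: "inj_on F {x. supp x \<subseteq> T}"
  shows "\<exists>c>0. \<forall>v. supp v \<subseteq> T \<longrightarrow> norm v \<le> c * norm (F v)"
proof (cases "T = {}")
  \<comment> \<open>For empty \<open>T\<close> there is no unit sphere to minimize over, but then
    \<open>v\<close> is zero.\<close>
  case True
  then have "norm v \<le> 1 * norm (F v)" if "supp v \<subseteq> T" for v
    using norm_finite_supp[OF T that] by simp
  then show ?thesis
    by (intro exI[of _ 1]) simp
next
  case False
  then obtain j where j: "j \<in> T" by blast
  \<comment> \<open>The sphere is modelled by coordinate functions inside the box, where compactness
    is available. Their values off \<open>T\<close> are free within the box, and \<open>g\<close>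
    ignores them.\<close>
  define K where "K = {f :: 'i \<Rightarrow> real. \<forall>i. \<bar>f i\<bar> \<le> 1} \<inter> {f. (\<Sum>i\<in>T. (f i)\<^sup>2) = 1}"
  define g where "g f = norm (\<Sum>i\<in>T. f i *\<^sub>R F (unit_vec i))" for f :: "'i \<Rightarrow> real"
  have "closed {f :: 'i \<Rightarrow> real. (\<Sum>i\<in>T. (f i)\<^sup>2) = 1}"
    by (intro closed_Collect_eq continuous_intros continuous_on_product_coordinates)
  then have "compact K"
    unfolding K_def by (intro compact_Int_closed compact_box)
  moreover have "K \<noteq> {}"
  proof -
    have "(\<Sum>i\<in>T. (of_bool (i = j) :: real)\<^sup>2) = (\<Sum>i\<in>T. if i = j then 1 else 0)"
      by (rule sum.cong) auto
    then have "(\<lambda>i. of_bool (i = j)) \<in> K"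
      using j T by (auto simp: K_def)
    then show ?thesis by blast
  qed
  moreover have "continuous_on K g"
    unfolding g_def
    by (intro continuous_intros continuous_on_subset[OF continuous_on_product_coordinates]) auto
  ultimately have "\<exists>f0\<in>K. \<forall>f\<in>K. g f0 \<le> g f"
    by (rule continuous_attains_inf)
  then obtain f0 where f0: "f0 \<in> K" "\<And>f. f \<in> K \<Longrightarrow> g f0 \<le> g f"
    by blast
  define v0 where "v0 = (\<Sum>i\<in>T. f0 i *\<^sub>R unit_vec i)"
  have cv0: "coord v0 i = (if i \<in> T then f0 i else 0)" for i
  proof -
    have "(\<Sum>k\<in>T. f0 k * of_bool (i = k)) = (\<Sum>k\<in>T. if k = i then f0 i else 0)"
      by (rule sum.cong) auto
    then show ?thesis
      using T by (simp add: v0_def)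
  qed
  then have supp_v0: "supp v0 \<subseteq> T"
    by (auto simp: supp_def split: if_splits)
  have "(norm v0)\<^sup>2 = 1"
    using f0(1) unfolding norm_finite_supp[OF T supp_v0] by (simp add: cv0 K_def)
  then have "v0 \<noteq> 0"
    by auto
  then have "F v0 \<noteq> F 0"
    using inj supp_v0 by (auto simp: inj_on_def supp_def)
  moreover have "g f0 = norm (F v0)"
    unfolding g_def linear_finite_supp[OF lin T supp_v0] by (simp add: cv0)
  ultimately have pos: "g f0 > 0"
    by (simp add: linear_0[OF lin])
  have "norm v \<le> 1 / g f0 * norm (F v)" if v: "supp v \<subseteq> T" for v
  proof (cases "v = 0")
    case False
    define f where "f i = coord v i / norm v" for i
    have "(\<Sum>i\<in>T. (f i)\<^sup>2) = (\<Sum>i\<in>T. (coord v i)\<^sup>2) / (norm v)\<^sup>2"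
      by (simp add: f_def power_divide sum_divide_distrib)
    then have "f \<in> K"
      using False abs_coord_le_norm[of v]
      by (simp add: K_def f_def norm_finite_supp[OF T v, symmetric] divide_le_eq)
    then have "g f0 \<le> g f"
      by (rule f0)
    also have "(\<Sum>i\<in>T. f i *\<^sub>R F (unit_vec i)) = F v /\<^sub>R norm v"
      unfolding linear_finite_supp[OF lin T v]
      by (simp add: f_def scaleR_sum_right divide_inverse mult.commute)
    then have "g f = norm (F v) / norm v"
      by (simp add: g_def divide_inverse mult.commute)
    finally show ?thesis
      using pos False by (simp add: field_simps)
  qed (use pos in simp)
  then show ?thesis
    using pos by (intro exI[of _ "1 / g f0"]) auto
qed

text \<open>Restricting \<open>\<xi>\<close> to a finite set leaves finitely many convergent
  coordinates, and the error is controlled uniformly in \<open>n\<close> by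
  \<open>M\<close>.\<close>

lemma weak_convergence_coordinatewise:
  fixes u :: "nat \<Rightarrow> 'i ell2"
  assumes bounded: "\<And>n. norm (u n) \<le> M"
    and coords: "\<And>i. (\<lambda>n. coord (u n) i) \<longlonglongrightarrow> 0"
  shows "(\<lambda>n. inner (u n) \<xi>) \<longlonglongrightarrow> 0"
proof (rule LIMSEQ_I)
  fix e :: real assume e: "e > 0"
  have M0: "M \<ge> 0"
    by (rule order_trans[OF norm_ge_zero bounded])
  have "((\<lambda>A. norm (restr A \<xi> - \<xi>)) \<longlongrightarrow> 0) (finite_subsets_at_top UNIV)"
    by (rule tendsto_norm_zero, subst Lim_null[symmetric]) (rule tendsto_restr)
  then have "\<forall>\<^sub>F A in finite_subsets_at_top UNIV. norm (restr A \<xi> - \<xi>) < e / (2 * (M + 1))"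
    using e M0 by (intro order_tendstoD(2)) auto
  then obtain A where A: "finite A" "norm (restr A \<xi> - \<xi>) < e / (2 * (M + 1))"
    unfolding eventually_finite_subsets_at_top by blast
  have "(\<lambda>n. \<Sum>i\<in>A. coord \<xi> i * coord (u n) i) \<longlonglongrightarrow> (\<Sum>i\<in>A. coord \<xi> i * 0)"
    by (intro tendsto_intros coords)
  then have "(\<lambda>n. \<Sum>i\<in>A. coord \<xi> i * coord (u n) i) \<longlonglongrightarrow> 0"
    by simp
  then obtain N where N: "\<And>n. n \<ge> N \<Longrightarrow> \<bar>\<Sum>i\<in>A. coord \<xi> i * coord (u n) i\<bar> < e / 2"
    using LIMSEQ_D[of _ 0 "e / 2"] e by force
  have "norm (inner (u n) \<xi> - 0) < e" if n: "n \<ge> N" for n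
  proof -
    have "inner (u n) \<xi> = inner (restr A \<xi>) (u n) - inner (u n) (restr A \<xi> - \<xi>)"
      by (simp add: inner_diff_right inner_commute)
    moreover have "inner (restr A \<xi>) (u n) = (\<Sum>i\<in>A. coord \<xi> i * coord (u n) i)"
      unfolding inner_finite_supp[OF A(1) supp_restr] by (simp add: coord_restr)
    moreover have "\<bar>inner (u n) (restr A \<xi> - \<xi>)\<bar> \<le> (M + 1) * (e / (2 * (M + 1)))"
    proof -
      have "\<bar>inner (u n) (restr A \<xi> - \<xi>)\<bar> \<le> norm (u n) * norm (restr A \<xi> - \<xi>)"
        by (rule Cauchy_Schwarz_ineq2)
      also have "\<dots> \<le> (M + 1) * (e / (2 * (M + 1)))"
        using A(2) bounded[of n] M0 by (intro mult_mono) auto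
      finally show ?thesis .
    qed
    moreover have "(M + 1) * (e / (2 * (M + 1))) = e / 2"
      using M0 by (simp add: field_simps)
    ultimately show ?thesis
      using N[OF n] unfolding real_norm_def by linarith
  qed
  then show "\<exists>N. \<forall>n\<ge>N. norm (inner (u n) \<xi> - 0) < e"
    by blast
qed

text \<open>Otherwise a sequence with images tending to \<open>F xd\<close> always has some
  coordinate more than \<open>\<epsilon>\<close> away from that of \<open>xd\<close>. A
  coordinatewise limit of a subsequence is again a minimizer, hence \<open>xd\<close>; the sum over
  the support then tends to its full value and leaves no room for the deviating coordinate.\<close>

lemma unique_minimizer_coord_stable:
  fixes F :: "('i::countable) ell2 \<Rightarrow> 'y::real_inner"
  assumes p: "0 < p" "p \<le> 2" and sparse: "is_sparse xd" and F: "bounded_linear F"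
    and uniq: "Sol p F (F xd) 0 = {xd}" and \<epsilon>: "0 < \<epsilon>"
  shows "\<exists>b>0. \<forall>x. Reg p x \<le> Reg p xd \<longrightarrow> norm (F x - F xd) \<le> b
           \<longrightarrow> (\<forall>i. \<bar>coord x i - coord xd i\<bar> \<le> \<epsilon>)"
proof (rule ccontr)
  assume contra: "\<not> ?thesis"
  note lin = bounded_linear.linear[OF F]
  define T where "T = supp xd"
  have T: "finite T" "supp xd \<subseteq> T"
    using sparse by (auto simp: is_sparse_def T_def)
  define R where "R = (\<Sum>i\<in>T. \<bar>coord xd i\<bar> powr p)"
  have R: "Reg p xd = ereal R"
    unfolding R_def by (rule Reg_finite_supp[OF T])
  define M where "M = R powr (1 / p)"
  have "\<exists>x. Reg p x \<le> ereal R \<and> norm (F x - F xd) \<le> inverse (real (Suc n))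
          \<and> (\<exists>i. \<epsilon> < \<bar>coord x i - coord xd i\<bar>)" for n
  proof -
    have "0 < inverse (real (Suc n))"
      by simp
    with contra show ?thesis
      unfolding R not_ex not_all not_imp not_le de_Morgan_conj by blast
  qed
  then obtain X where X: "\<And>n. Reg p (X n) \<le> ereal R"
      "\<And>n. norm (F (X n) - F xd) \<le> inverse (real (Suc n))"
      "\<And>n. \<exists>i. \<epsilon> < \<bar>coord (X n) i - coord xd i\<bar>"
    by metis
  have norm_X: "norm (X n) \<le> M" for n
    unfolding M_def using X(1)[of n] by (intro norm_le_of_powr_sums[OF p]) (auto simp: Reg_le_iff)
  have "\<forall>n. coord (X n) \<in> {f. \<forall>i. \<bar>f i\<bar> \<le> M}"
    using order_trans[OF abs_coord_le_norm norm_X] by simp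
  \<comment> \<open>Countability of the index type makes the product topology first countable, so
    compactness yields a convergent subsequence.\<close>
  then obtain f r where r: "strict_mono r" and "((\<lambda>n. coord (X n)) \<circ> r) \<longlonglongrightarrow> f"
    by (rule seq_compactE[OF compact_imp_seq_compact[OF compact_box[of M]]])
  then have lim: "(\<lambda>n. coord (X (r n))) \<longlonglongrightarrow> f"
    by (simp add: comp_def)
  have lim_coord: "(\<lambda>n. coord (X (r n)) i) \<longlonglongrightarrow> f i" for i
    by (rule continuous_on_tendsto_compose[OF continuous_on_product_coordinates[of i] lim]) auto
  have "(\<Sum>i\<in>A. (f i)\<^sup>2) \<le> M\<^sup>2" if "finite A" for A
  proof (rule LIMSEQ_le_const2)
    show "(\<lambda>n. \<Sum>i\<in>A. (coord (X (r n)) i)\<^sup>2) \<longlonglongrightarrow> (\<Sum>i\<in>A. (f i)\<^sup>2)"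
      by (intro tendsto_intros lim_coord)
    have "(\<Sum>i\<in>A. (coord (X (r n)) i)\<^sup>2) \<le> M\<^sup>2" for n
      using sum_coord_sq_le[OF that, of "X (r n)"] norm_X[of "r n"]
      by (meson norm_ge_zero order_trans power_mono)
    then show "\<exists>N. \<forall>n\<ge>N. (\<Sum>i\<in>A. (coord (X (r n)) i)\<^sup>2) \<le> M\<^sup>2"
      by blast
  qed
  then have "(\<lambda>i. (f i)\<^sup>2) summable_on UNIV"
    by (intro nonneg_bounded_partial_sums_imp_summable_on[where C = "M\<^sup>2"])
       (auto intro!: eventually_finite_subsets_at_top_weakI)
  then obtain xs where xs: "coord xs = f"
    using coord_Abs_ell2 by blast
  have lim_powr: "(\<lambda>n. \<Sum>i\<in>A. \<bar>coord (X (r n)) i\<bar> powr p) \<longlonglongrightarrow> (\<Sum>i\<in>A. \<bar>f i\<bar> powr p)" for A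
    using p by (intro tendsto_sum tendsto_powr2 tendsto_rabs lim_coord tendsto_const) auto
  \<comment> \<open>Lower semicontinuity: the bound passes to the limit in each finite sum.\<close>
  have "Reg p xs \<le> ereal R"
    unfolding Reg_le_iff xs
  proof (intro allI impI)
    fix A :: "'i set" assume "finite A"
    then show "(\<Sum>i\<in>A. \<bar>f i\<bar> powr p) \<le> R"
      using X(1) by (intro LIMSEQ_le_const2[OF lim_powr]) (auto simp: Reg_le_iff)
  qed
  moreover have "F xs = F xd"
  proof -
    \<comment> \<open>Pairing with the residual \<open>\<omega>\<close> itself: \<open>u n\<close>
      tends weakly to 0 while \<open>F (X (r n))\<close> tends to \<open>F xd\<close> in norm, so
      \<open>inner \<omega> \<omega> = 0\<close>.\<close>
    define \<omega> where "\<omega> = F xs - F xd"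
    define u where "u n = X (r n) - xs" for n
    have "(\<lambda>n. coord (X (r n)) i - f i) \<longlonglongrightarrow> f i - f i" for i
      by (intro tendsto_diff tendsto_const lim_coord)
    then have "(\<lambda>n. coord (u n) i) \<longlonglongrightarrow> 0" for i
      by (simp add: u_def xs)
    moreover have "norm (u n) \<le> M + norm xs" for n
      using norm_triangle_ineq4[of "X (r n)" xs] norm_X[of "r n"] by (simp add: u_def)
    ultimately have "(\<lambda>n. inner (u n) (adjoint F \<omega>)) \<longlonglongrightarrow> 0"
      by (intro weak_convergence_coordinatewise)
    then have "(\<lambda>n. inner (F (u n)) \<omega> + inner \<omega> \<omega>) \<longlonglongrightarrow> 0 + inner \<omega> \<omega>"
      unfolding ell2_adjoint[OF F] by (intro tendsto_add tendsto_const)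
    moreover have "inner (F (u n)) \<omega> + inner \<omega> \<omega> = inner (F (X (r n)) - F xd) \<omega>" for n
      by (simp add: u_def linear_diff[OF lin] \<omega>_def flip: inner_add_left)
    moreover have "(\<lambda>n. inner (F (X (r n)) - F xd) \<omega>) \<longlonglongrightarrow> inner 0 \<omega>"
    proof (intro tendsto_inner tendsto_const)
      have "(\<lambda>n. inverse (real (Suc (r n)))) \<longlonglongrightarrow> 0"
        using LIMSEQ_subseq_LIMSEQ[OF LIMSEQ_inverse_real_of_nat r] by (simp add: comp_def)
      then show "(\<lambda>n. F (X (r n)) - F xd) \<longlonglongrightarrow> 0"
        by (rule Lim_null_comparison[rotated]) (use X(2) in auto)
    qed
    ultimately have "inner \<omega> \<omega> = 0"
      using LIMSEQ_unique by fastforce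
    then show ?thesis
      by (simp add: \<omega>_def)
  qed
  moreover have "xd \<in> Sol p F (F xd) 0"
    using uniq by simp
  ultimately have "xs \<in> Sol p F (F xd) 0"
    using R unfolding Sol_def is_arg_min_def by (auto dest: order.strict_trans2)
  then have f: "f = coord xd"
    using uniq xs by auto
  \<comment> \<open>On the finite set \<open>T\<close> coordinatewise convergence is uniform, so the
    deviating index eventually lies off the support.\<close>
  have "\<forall>\<^sub>F n in sequentially. \<forall>i\<in>T. \<bar>coord (X (r n)) i - coord xd i\<bar> < \<epsilon>"
    using T(1)
  proof (rule eventually_ball_finite, intro ballI)
    fix i
    show "\<forall>\<^sub>F n in sequentially. \<bar>coord (X (r n)) i - coord xd i\<bar> < \<epsilon>"
      using tendstoD[OF lim_coord \<epsilon>, of i] by (simp add: f dist_real_def)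
  qed
  \<comment> \<open>Less than \<open>\<epsilon> powr p\<close> of the bound \<open>R\<close> remains
    off \<open>T\<close>, too little for a coordinate above \<open>\<epsilon>\<close>.\<close>
  moreover have "\<forall>\<^sub>F n in sequentially. R - \<epsilon> powr p < (\<Sum>i\<in>T. \<bar>coord (X (r n)) i\<bar> powr p)"
    using \<epsilon> by (intro order_tendstoD(1)[OF lim_powr]) (simp add: f R_def)
  ultimately have "\<forall>\<^sub>F n in sequentially. False"
  proof eventually_elim
    case (elim n)
    obtain i where i: "\<epsilon> < \<bar>coord (X (r n)) i - coord xd i\<bar>"
      using X(3) by blast
    then have "i \<notin> T"
      using elim(1) by force
    then have "coord xd i = 0"
      by (auto simp: T_def supp_def)
    then have "\<epsilon> powr p \<le> \<bar>coord (X (r n)) i\<bar> powr p"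
      using i p \<epsilon> by (intro powr_mono2) auto
    moreover have "(\<Sum>i\<in>insert i T. \<bar>coord (X (r n)) i\<bar> powr p) \<le> R"
      using X(1)[of "r n"] T(1) unfolding Reg_le_iff by blast
    ultimately show False
      using elim(2) \<open>i \<notin> T\<close> T(1) by simp
  qed
  then show False
    by simp
qed

section \<open>Splitting a competitor into its parts on and off \<open>T\<close>\<close>

text \<open>The total over \<open>T\<close> and \<open>A - T\<close> is at most that of
  \<open>xd\<close>, which lives on \<open>T\<close>. Mass off \<open>T\<close> is thus paid for by
  a decrease on \<open>T\<close>.\<close>

lemma sum_off_support_le:
  assumes le: "Reg p x \<le> Reg p xd" and T: "finite T" "supp xd \<subseteq> T" and A: "finite A"
  shows "(\<Sum>i\<in>A. \<bar>coord (restr (- T) x) i\<bar> powr p)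
           \<le> (\<Sum>i\<in>T. \<bar>coord xd i\<bar> powr p) - (\<Sum>i\<in>T. \<bar>coord x i\<bar> powr p)"
proof -
  have "(\<Sum>i\<in>(A - T) \<union> T. \<bar>coord x i\<bar> powr p) \<le> (\<Sum>i\<in>T. \<bar>coord xd i\<bar> powr p)"
    using le T(1) A by (simp add: Reg_finite_supp[OF T] Reg_le_iff)
  also have "(\<Sum>i\<in>(A - T) \<union> T. \<bar>coord x i\<bar> powr p)
      = (\<Sum>i\<in>A - T. \<bar>coord x i\<bar> powr p) + (\<Sum>i\<in>T. \<bar>coord x i\<bar> powr p)"
    using T A by (intro sum.union_disjoint) auto
  also have "(\<Sum>i\<in>A - T. \<bar>coord x i\<bar> powr p) = (\<Sum>i\<in>A. \<bar>coord (restr (- T) x) i\<bar> powr p)"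
    using A by (intro sum.mono_neutral_cong_left) (auto simp: coord_restr)
  finally show ?thesis
    by simp
qed

lemma restr_Compl_diff_supp:
  assumes "supp xd \<subseteq> T"
  shows "restr (- T) (x - xd) = restr (- T) x"
  using assms by (intro ell2_eqI) (auto simp: coord_restr supp_def)

text \<open>Apply the lower bound to \<open>restr T h\<close>, which is \<open>h\<close> minus its
  part off \<open>T\<close>; the image of that part costs at most \<open>K\<close> times its norm.
  It then remains to control the part off \<open>T\<close>.\<close>

lemma norm_le_image_and_off_support:
  fixes F :: "'i ell2 \<Rightarrow> 'y::real_normed_vector"
  assumes lin: "linear F" and K: "\<And>x. norm (F x) \<le> norm x * K"
    and c: "0 \<le> c" "\<And>v. supp v \<subseteq> T \<Longrightarrow> norm v \<le> c * norm (F v)"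
  shows "norm h \<le> c * norm (F h) + (1 + c * K) * norm (restr (- T) h)"
proof -
  define w where "w = restr (- T) h"
  have h: "h = restr T h + w"
    by (simp add: w_def restr_add_restr_Compl)
  have "restr T h = h - w"
    using h by (simp add: algebra_simps)
  then have "norm (F (restr T h)) \<le> norm (F h) + norm (F w)"
    by (simp add: linear_diff[OF lin] norm_triangle_ineq4)
  also have "\<dots> \<le> norm (F h) + norm w * K"
    using K[of w] by simp
  finally have "c * norm (F (restr T h)) \<le> c * (norm (F h) + norm w * K)"
    using c(1) by (rule mult_left_mono)
  moreover have "norm (restr T h) \<le> c * norm (F (restr T h))"
    by (rule c(2)) (rule supp_restr)
  moreover have "norm h \<le> norm (restr T h) + norm w"
    using norm_triangle_ineq[of "restr T h" w] h by simp
  ultimately show ?thesis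
    by (simp add: w_def algebra_simps)
qed

section \<open>Subgradients and the rate for exponents at least 1\<close>

text \<open>Perturb \<open>xd\<close> in the single coordinate \<open>i\<close>: both supports are
  finite, and all other terms cancel.\<close>

lemma subgradient_coord_le:
  assumes \<xi>: "\<xi> \<in> subdifferential (Reg p) xd" and sparse: "is_sparse xd"
  shows "coord \<xi> i * t \<le> \<bar>coord xd i + t\<bar> powr p - \<bar>coord xd i\<bar> powr p"
proof -
  define A where "A = insert i (supp xd)"
  have A: "finite A" "supp xd \<subseteq> A" "supp (xd + t *\<^sub>R unit_vec i) \<subseteq> A"
    using sparse by (auto simp: A_def is_sparse_def supp_def)
  have "Reg p xd + ereal (inner \<xi> (xd + t *\<^sub>R unit_vec i - xd)) \<le> Reg p (xd + t *\<^sub>R unit_vec i)"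
    using \<xi> unfolding subdifferential_def by blast
  moreover have "inner \<xi> (unit_vec i) = coord \<xi> i"
    using inner_finite_supp[of "{i}" "unit_vec i" \<xi>] by (simp add: inner_commute supp_def)
  ultimately have "(\<Sum>j\<in>A. \<bar>coord xd j\<bar> powr p) + coord \<xi> i * t
      \<le> (\<Sum>j\<in>A. \<bar>coord (xd + t *\<^sub>R unit_vec i) j\<bar> powr p)"
    unfolding Reg_finite_supp[OF A(1,2)] Reg_finite_supp[OF A(1,3)] by (simp add: mult.commute)
  moreover have "(\<Sum>j\<in>A - {i}. \<bar>coord (xd + t *\<^sub>R unit_vec i) j\<bar> powr p)
      = (\<Sum>j\<in>A - {i}. \<bar>coord xd j\<bar> powr p)"
    by (rule sum.cong) auto
  ultimately show ?thesis
    using A(1) sum.remove[of A i "\<lambda>j. \<bar>coord xd j\<bar> powr p"]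
      sum.remove[of A i "\<lambda>j. \<bar>coord (xd + t *\<^sub>R unit_vec i) j\<bar> powr p"]
    by (simp add: A_def)
qed

text \<open>For \<open>p > 1\<close> the increment \<open>\<bar>t\<bar> powr p\<close> is of smaller
  order than \<open>\<bar>t\<bar>\<close> near 0, so a linear function below it has slope 0.\<close>

lemma subgradient_coord_zero:
  assumes "1 < p" "\<xi> \<in> subdifferential (Reg p) xd" "is_sparse xd" "i \<notin> supp xd"
  shows "coord \<xi> i = 0"
proof (rule ccontr)
  define a where "a = \<bar>coord \<xi> i\<bar>"
  assume "coord \<xi> i \<noteq> 0"
  then have a: "a > 0"
    by (simp add: a_def)
  \<comment> \<open>Chosen so that \<open>s powr p\<close> is half of \<open>a * s\<close>, against
    the subgradient inequality for a step of size \<open>s\<close> in the direction of the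
    sign.\<close>
  define s where "s = (a / 2) powr (1 / (p - 1))"
  have s: "s > 0"
    using a by (simp add: s_def)
  have "s powr (p - 1) = a / 2"
    using a assms(1) by (simp add: s_def powr_powr)
  have "a * s \<le> s powr p"
    using subgradient_coord_le[OF assms(2,3), of i "sgn (coord \<xi> i) * s"] assms(4) s
    by (simp add: supp_def a_def abs_mult abs_sgn_eq sgn_if split: if_splits)
  also have "\<dots> = s * s powr (p - 1)"
    using s by (simp add: powr_diff)
  also have "\<dots> = s * (a / 2)"
    by (simp add: \<open>s powr (p - 1) = a / 2\<close>)
  finally show False
    using a s by (simp add: mult.commute)
qed

text \<open>Serves both convex cases: \<open>m = 0\<close> with \<open>T\<close> the support if
  \<open>p > 1\<close>, and for \<open>p = 1\<close> a bound \<open>m < 1\<close> on the subgradient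
  off the set where it has modulus 1.\<close>

lemma subgradient_rate:
  fixes F :: "'i ell2 \<Rightarrow> 'y::real_inner"
  assumes p: "1 \<le> p" "p \<le> 2" and F: "bounded_linear F"
    and T: "finite T" "supp xd \<subseteq> T" and inj: "inj_on F {x. supp x \<subseteq> T}"
    and \<xi>: "\<xi> \<in> subdifferential (Reg p) xd" "\<xi> = adjoint F \<omega>"
    and m: "0 \<le> m" "m < 1" "\<And>i t. i \<notin> T \<Longrightarrow> \<bar>coord \<xi> i * t\<bar> \<le> m * \<bar>t\<bar> powr p"
  shows "\<exists>C\<ge>0. \<exists>b>0. \<forall>\<beta> x. 0 < \<beta> \<longrightarrow> \<beta> \<le> b \<longrightarrow> Reg p x \<le> Reg p xd
           \<longrightarrow> norm (F (x - xd)) \<le> 2 * \<beta> \<longrightarrow> norm (x - xd) \<le> C * \<beta> powr min 1 (1 / p)"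
proof -
  note lin = bounded_linear.linear[OF F]
  obtain K where K: "K \<ge> 0" "\<And>x. norm (F x) \<le> norm x * K"
    using bounded_linear.nonneg_bounded[OF F] by blast
  obtain c where c: "c > 0" "\<And>v. supp v \<subseteq> T \<Longrightarrow> norm v \<le> c * norm (F v)"
    using inj_finite_supp_lower_bound[OF lin T(1) inj] by blast
  define D where "D = 2 * norm \<omega> / (1 - m)"
  define C where "C = c * 2 + (1 + c * K) * D powr (1 / p)"
  have D0: "D \<ge> 0"
    using m by (simp add: D_def)
  have bound: "norm (x - xd) \<le> C * \<beta> powr min 1 (1 / p)"
    if \<beta>: "0 < \<beta>" "\<beta> \<le> 1" and x: "Reg p x \<le> Reg p xd" "norm (F (x - xd)) \<le> 2 * \<beta>" for \<beta> x
  proof -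
    define w where "w = restr (- T) x"
    define G where "G = (\<Sum>i\<in>T. \<bar>coord xd i\<bar> powr p) - (\<Sum>i\<in>T. \<bar>coord x i\<bar> powr p)"
    have sum_w: "(\<Sum>i\<in>A. \<bar>coord w i\<bar> powr p) \<le> G" if "finite A" for A
      unfolding w_def G_def by (rule sum_off_support_le[OF x(1) T that])
    have inner_w: "inner \<xi> w \<le> m * G"
      unfolding inner_ell2_def
    proof (rule infsum_le_finite_sums[OF coord_mult_summable])
      fix A :: "'i set" assume A: "finite A"
      have "(\<Sum>i\<in>A. coord \<xi> i * coord w i) \<le> (\<Sum>i\<in>A. m * \<bar>coord w i\<bar> powr p)"
      proof (rule sum_mono)
        fix i
        show "coord \<xi> i * coord w i \<le> m * \<bar>coord w i\<bar> powr p"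
          using m(3)[of i "coord w i"] by (cases "i \<in> T") (auto simp: w_def coord_restr)
      qed
      also have "\<dots> \<le> m * G"
        unfolding sum_distrib_left[symmetric] by (intro mult_left_mono sum_w A m)
      finally show "(\<Sum>i\<in>A. coord \<xi> i * coord w i) \<le> m * G" .
    qed
    \<comment> \<open>The test point is supported in the finite set \<open>T\<close>, so both values
      of \<open>Reg\<close> are finite and differ by exactly \<open>G\<close>.\<close>
    have "Reg p xd + ereal (inner \<xi> (restr T x - xd)) \<le> Reg p (restr T x)"
      using \<xi>(1) unfolding subdifferential_def by blast
    then have "inner \<xi> (restr T x - xd) \<le> - G"
      unfolding Reg_finite_supp[OF T] Reg_finite_supp[OF T(1) supp_restr]
      by (simp add: G_def coord_restr)
    moreover have "restr T x - xd = (x - xd) - w"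
      using restr_add_restr_Compl[of T x] by (simp add: w_def algebra_simps)
    moreover have "- inner \<xi> (x - xd) \<le> 2 * \<beta> * norm \<omega>"
    proof -
      have "inner \<xi> (x - xd) = inner (F (x - xd)) \<omega>"
        by (simp only: \<xi>(2) ell2_adjoint[OF F] inner_commute[of _ "x - xd"])
      moreover have "\<bar>inner (F (x - xd)) \<omega>\<bar> \<le> 2 * \<beta> * norm \<omega>"
        using Cauchy_Schwarz_ineq2[of "F (x - xd)" \<omega>] mult_right_mono[OF x(2), of "norm \<omega>"]
        by simp
      ultimately show ?thesis
        by simp
    qed
    \<comment> \<open>Altogether \<open>G\<close> is at most
      \<open>2 * \<beta> * norm \<omega> + m * G\<close>, and \<open>m < 1\<close> allows the last
      term to be absorbed.\<close>
    ultimately have "(1 - m) * G \<le> 2 * \<beta> * norm \<omega>"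
      using inner_w by (simp add: inner_diff_right algebra_simps)
    then have "G \<le> D * \<beta>"
      using m(2) by (simp add: D_def field_simps)
    then have "norm w \<le> (D * \<beta>) powr (1 / p)"
      using p sum_w by (intro norm_le_of_powr_sums) (auto intro: order_trans)
    then have w: "norm w \<le> D powr (1 / p) * \<beta> powr (1 / p)"
      using D0 \<beta> by (simp add: powr_mult)
    \<comment> \<open>For \<open>\<beta> \<le> 1\<close> the linear contribution of the image is
      dominated by the slower rate; hence \<open>b = 1\<close> at the end.\<close>
    have "\<beta> powr 1 \<le> \<beta> powr (1 / p)"
      using \<beta> p by (intro powr_mono') auto
    then have \<beta>p: "\<beta> \<le> \<beta> powr (1 / p)"
      using \<beta> by simp
    have "norm (x - xd) \<le> c * norm (F (x - xd)) + (1 + c * K) * norm w"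
      using norm_le_image_and_off_support[OF lin K(2), of c T "x - xd"] c
      by (simp add: w_def restr_Compl_diff_supp[OF T(2)])
    also have "\<dots> \<le> c * (2 * \<beta> powr (1 / p)) + (1 + c * K) * (D powr (1 / p) * \<beta> powr (1 / p))"
      using c(1) K(1) x(2) w \<beta>p by (intro add_mono mult_left_mono) auto
    also have "\<dots> = C * \<beta> powr (1 / p)"
      by (simp add: C_def algebra_simps)
    also have "1 / p = min 1 (1 / p)"
      using p by simp
    finally show ?thesis .
  qed
  moreover have "C \<ge> 0"
    using c(1) K(1) by (simp add: C_def)
  ultimately show ?thesis
    by (intro exI[of _ C] conjI exI[of _ 1]) auto
qed

section \<open>The linear rate for exponents below 1\<close>

lemma unique_minimizer_rate:
  fixes F :: "('i::countable) ell2 \<Rightarrow> 'y::real_inner"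
  assumes p: "0 < p" "p < 1" and sparse: "is_sparse xd" and F: "bounded_linear F"
    and uniq: "Sol p F (F xd) 0 = {xd}" and inj: "inj_on F {x. supp x \<subseteq> supp xd}"
  shows "\<exists>C\<ge>0. \<exists>b>0. \<forall>\<beta> x. 0 < \<beta> \<longrightarrow> \<beta> \<le> b \<longrightarrow> Reg p x \<le> Reg p xd
           \<longrightarrow> norm (F (x - xd)) \<le> 2 * \<beta> \<longrightarrow> norm (x - xd) \<le> C * \<beta> powr min 1 (1 / p)"
proof -
  note lin = bounded_linear.linear[OF F]
  define T where "T = supp xd"
  have T: "finite T" "supp xd \<subseteq> T"
    using sparse by (auto simp: is_sparse_def T_def)
  obtain K where K: "K \<ge> 0" "\<And>x. norm (F x) \<le> norm x * K"
    using bounded_linear.nonneg_bounded[OF F] by blast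
  obtain c where c: "c > 0" "\<And>v. supp v \<subseteq> T \<Longrightarrow> norm v \<le> c * norm (F v)"
    using inj_finite_supp_lower_bound[OF lin T(1)] inj unfolding T_def by blast
  \<comment> \<open>\<open>L\<close> bounds the slope of the decrease on \<open>T\<close>.
    \<open>N\<close> makes \<open>(1 + c * K) * L \<le> N / 2\<close>, with 1 added to keep it
    positive. As \<open>p - 1\<close> is negative, \<open>\<delta>\<close> is the modulus up to
    which \<open>\<bar>t\<bar> powr p\<close> dominates \<open>N * \<bar>t\<bar>\<close>.\<close>
  define L where "L = (\<Sum>i\<in>T. \<bar>coord xd i\<bar> powr (p - 1))"
  define N where "N = 2 * (1 + c * K) * L + 1"
  define \<delta> where "\<delta> = N powr (1 / (p - 1))"
  have L0: "L \<ge> 0"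
    unfolding L_def by (intro sum_nonneg) auto
  have N0: "N > 0"
    using L0 c K(1) by (simp add: N_def add_nonneg_pos)
  have \<delta>0: "\<delta> > 0"
    using N0 by (simp add: \<delta>_def)
  have \<delta>N: "\<delta> powr (p - 1) = N"
    using N0 p by (simp add: \<delta>_def powr_powr)
  obtain b where b: "b > 0" "\<And>x i. \<lbrakk>Reg p x \<le> Reg p xd; norm (F x - F xd) \<le> b\<rbrakk>
      \<Longrightarrow> \<bar>coord x i - coord xd i\<bar> \<le> \<delta>"
    using unique_minimizer_coord_stable[OF p(1) _ sparse F uniq \<delta>0] p by auto
  have bound: "norm (x - xd) \<le> 4 * c * \<beta> powr min 1 (1 / p)"
    if \<beta>: "0 < \<beta>" "\<beta> \<le> b / 2" and x: "Reg p x \<le> Reg p xd" "norm (F (x - xd)) \<le> 2 * \<beta>" for \<beta> x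
  proof -
    define w where "w = restr (- T) x"
    define G where "G = (\<Sum>i\<in>T. \<bar>coord xd i\<bar> powr p) - (\<Sum>i\<in>T. \<bar>coord x i\<bar> powr p)"
    have sum_w: "(\<Sum>i\<in>A. \<bar>coord w i\<bar> powr p) \<le> G" if "finite A" for A
      unfolding w_def G_def by (rule sum_off_support_le[OF x(1) T that])
    \<comment> \<open>The range \<open>\<beta> \<le> b / 2\<close> turns the residual bound
      \<open>2 * \<beta>\<close> into the \<open>b\<close> required for stability.\<close>
    have small: "\<bar>coord x i - coord xd i\<bar> \<le> \<delta>" for i
      using \<beta> x by (intro b(2)) (auto simp: linear_diff[OF lin])
    have w_le: "N * \<bar>coord w i\<bar> \<le> \<bar>coord w i\<bar> powr p" for i
    proof (cases "coord w i = 0")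
      case False
      then have "i \<notin> T"
        by (auto simp: w_def coord_restr)
      then have "\<bar>coord w i\<bar> \<le> \<delta>"
        using small[of i] by (simp add: w_def coord_restr T_def supp_def)
      then have "N \<le> \<bar>coord w i\<bar> powr (p - 1)"
        using False p unfolding \<delta>N[symmetric] by (intro powr_mono2') auto
      then show ?thesis
        using False by (simp add: powr_diff field_simps)
    qed simp
    have "norm w \<le> (G / N) powr (1 / 1)"
    proof (rule norm_le_of_powr_sums)
      fix A :: "'i set" assume A: "finite A"
      have "N * (\<Sum>i\<in>A. \<bar>coord w i\<bar>) \<le> (\<Sum>i\<in>A. \<bar>coord w i\<bar> powr p)"
        unfolding sum_distrib_left by (intro sum_mono w_le)
      also have "\<dots> \<le> G"
        by (rule sum_w) fact
      finally show "(\<Sum>i\<in>A. \<bar>coord w i\<bar> powr 1) \<le> G / N"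
        using N0 by (simp add: field_simps)
    qed auto
    also have "\<dots> = G / N"
      using sum_w[of "{}"] N0 by simp
    also have "G \<le> L * norm (x - xd)"
    proof -
      \<comment> \<open>The chord of the concave power function from 0 to
        \<open>\<bar>a\<bar>\<close> lies below the graph and has slope
        \<open>\<bar>a\<bar> powr (p - 1)\<close>. If \<open>\<bar>a'\<bar>\<close> exceeds
        \<open>\<bar>a\<bar>\<close>, the left side is not positive.\<close>
      have concave: "\<bar>a\<bar> powr p - \<bar>a'\<bar> powr p \<le> \<bar>a\<bar> powr (p - 1) * \<bar>a' - a\<bar>" if "a \<noteq> 0" for a a' :: real
      proof (cases "\<bar>a'\<bar> \<le> \<bar>a\<bar>")
        case True
        then have "(\<bar>a'\<bar> / \<bar>a\<bar>) powr 1 \<le> (\<bar>a'\<bar> / \<bar>a\<bar>) powr p"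
          using that p by (intro powr_mono') auto
        then have "\<bar>a\<bar> powr p * (\<bar>a'\<bar> / \<bar>a\<bar>) \<le> \<bar>a\<bar> powr p * (\<bar>a'\<bar> / \<bar>a\<bar>) powr p"
          by (intro mult_left_mono) auto
        also have "\<dots> = \<bar>a'\<bar> powr p"
          using that by (simp add: powr_divide)
        finally have "\<bar>a\<bar> powr p - \<bar>a'\<bar> powr p \<le> \<bar>a\<bar> powr (p - 1) * (\<bar>a\<bar> - \<bar>a'\<bar>)"
          using that by (simp add: powr_diff field_simps)
        also have "\<dots> \<le> \<bar>a\<bar> powr (p - 1) * \<bar>a' - a\<bar>"
          by (intro mult_left_mono) auto
        finally show ?thesis .
      next
        case False
        then have "\<bar>a\<bar> powr p \<le> \<bar>a'\<bar> powr p"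
          using p by (intro powr_mono2) auto
        moreover have "0 \<le> \<bar>a\<bar> powr (p - 1) * \<bar>a' - a\<bar>"
          by simp
        ultimately show ?thesis
          by linarith
      qed
      have "G = (\<Sum>i\<in>T. \<bar>coord xd i\<bar> powr p - \<bar>coord x i\<bar> powr p)"
        by (simp add: G_def sum_subtractf)
      also have "\<dots> \<le> (\<Sum>i\<in>T. \<bar>coord xd i\<bar> powr (p - 1) * norm (x - xd))"
      proof (rule sum_mono)
        fix i assume "i \<in> T"
        then have "\<bar>coord xd i\<bar> powr p - \<bar>coord x i\<bar> powr p
            \<le> \<bar>coord xd i\<bar> powr (p - 1) * \<bar>coord x i - coord xd i\<bar>"
          by (intro concave) (simp add: T_def supp_def)
        also have "\<dots> \<le> \<bar>coord xd i\<bar> powr (p - 1) * norm (x - xd)"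
          using abs_coord_le_norm[of "x - xd" i] by (intro mult_left_mono) auto
        finally show "\<bar>coord xd i\<bar> powr p - \<bar>coord x i\<bar> powr p
            \<le> \<bar>coord xd i\<bar> powr (p - 1) * norm (x - xd)" .
      qed
      also have "\<dots> = L * norm (x - xd)"
        by (simp add: L_def sum_distrib_right)
      finally show ?thesis .
    qed
    finally have w: "N * norm w \<le> L * norm (x - xd)"
      using N0 by (simp add: field_simps)
    \<comment> \<open>By the choice of \<open>N\<close> the off-support term is at most half the
      error; absorbing it doubles \<open>2 * c * \<beta>\<close> to the final
      \<open>4 * c * \<beta>\<close>.\<close>
    have "(1 + c * K) * norm w \<le> norm (x - xd) / 2"
    proof -
      have "N * ((1 + c * K) * norm w) \<le> (1 + c * K) * L * norm (x - xd)"
        using mult_left_mono[OF w, of "1 + c * K"] c(1) K(1) by (simp add: mult_ac)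
      also have "\<dots> \<le> (N / 2) * norm (x - xd)"
        by (intro mult_right_mono) (auto simp: N_def algebra_simps)
      finally have "N * ((1 + c * K) * norm w) \<le> N * (norm (x - xd) / 2)"
        by simp
      then show ?thesis
        using N0 mult_le_cancel_left_pos by blast
    qed
    moreover have "norm (x - xd) \<le> c * norm (F (x - xd)) + (1 + c * K) * norm w"
      using norm_le_image_and_off_support[OF lin K(2), of c T "x - xd"] c
      by (simp add: w_def restr_Compl_diff_supp[OF T(2)])
    moreover have "c * norm (F (x - xd)) \<le> c * (2 * \<beta>)"
      using c(1) x(2) by (intro mult_left_mono) auto
    moreover have "min 1 (1 / p) = 1"
      using p by simp
    ultimately show ?thesis
      using \<beta> by simp
  qed
  then show ?thesis
    using c(1) b(1) by (intro exI[of _ "4 * c"] conjI exI[of _ "b / 2"]) auto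
qed

section \<open>From the estimate for competitors to the order of the supremum\<close>

text \<open>\<open>xd\<close> is itself feasible, so a minimizer has no larger \<open>Reg\<close>;
  its residual and that of \<open>xd\<close> add up to the \<open>2 * \<beta>\<close> in the
  estimate.\<close>

lemma worst_case_error_bigo:
  assumes F: "linear F" and C: "0 \<le> C" and b: "0 < b"
    and bound: "\<And>\<beta> x. \<lbrakk>0 < \<beta>; \<beta> \<le> b; Reg p x \<le> Reg p xd; norm (F (x - xd)) \<le> 2 * \<beta>\<rbrakk>
      \<Longrightarrow> norm (x - xd) \<le> C * \<beta> powr r"
  shows "(\<forall>\<^sub>F \<beta> in at_right 0. worst_case_error p F xd \<beta> < \<infinity>)
       \<and> (\<lambda>\<beta>. enn2real (worst_case_error p F xd \<beta>)) \<in> O[at_right 0](\<lambda>\<beta>. \<beta> powr r)"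
proof -
  have le: "worst_case_error p F xd \<beta> \<le> ennreal (C * \<beta> powr r)" if \<beta>: "0 < \<beta>" "\<beta> \<le> b" for \<beta>
    unfolding worst_case_error_def
  proof (rule Sup_least, clarify)
    fix x y
    assume x: "x \<in> Sol p F y \<beta>" and y: "norm (F xd - y) \<le> \<beta>"
    have "Reg p x \<le> Reg p xd" and Fx: "norm (F x - y) \<le> \<beta>"
      using x y by (auto simp: Sol_def is_arg_min_linorder)
    moreover have "norm (F (x - xd)) \<le> 2 * \<beta>"
      using norm_triangle_ineq4[of "F x - y" "F xd - y"] Fx y by (simp add: linear_diff[OF F])
    ultimately show "ennreal (norm (x - xd)) \<le> ennreal (C * \<beta> powr r)"
      using \<beta> by (intro ennreal_leI bound)
  qed
  have ev: "\<forall>\<^sub>F \<beta> in at_right 0. 0 < \<beta> \<and> \<beta> < b"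
    using b by (auto simp: eventually_at_right_field)
  have "\<forall>\<^sub>F \<beta> in at_right 0. worst_case_error p F xd \<beta> < \<infinity>"
    using ev
  proof eventually_elim
    case (elim \<beta>)
    then show ?case
      using le[of \<beta>] by (auto intro: order.strict_trans1)
  qed
  moreover have "(\<lambda>\<beta>. enn2real (worst_case_error p F xd \<beta>)) \<in> O[at_right 0](\<lambda>\<beta>. \<beta> powr r)"
  proof (rule bigoI[of _ C])
    show "\<forall>\<^sub>F \<beta> in at_right 0. norm (enn2real (worst_case_error p F xd \<beta>)) \<le> C * norm (\<beta> powr r)"
      using ev
    proof eventually_elim
      case (elim \<beta>)
      then have "enn2real (worst_case_error p F xd \<beta>) \<le> C * \<beta> powr r"
        using le[of \<beta>] C by (intro enn2real_leI) auto
      then show ?case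
        by simp
    qed
  qed
  ultimately show ?thesis
    by blast
qed

text \<open>Since \<open>enn2real\<close> sends infinity to 0, the order estimate alone would not
  exclude an infinite supremum; the first conjunct does.\<close>

theorem proposition6p7:
  fixes F :: "('i::countable) ell2 \<Rightarrow> 'y::{real_inner, complete_space}"
    and xd :: "'i ell2"
    and p :: real
  assumes "0 < p" and "p < 2"
    and "is_sparse xd"
    and "bounded_linear F"
    and "(1 < p \<and> (\<exists>\<omega>. subdifferential (Reg p) xd = {adjoint F \<omega>})
            \<and> inj_on F {x. supp x \<subseteq> supp xd})
       \<or> (p = 1 \<and> (\<exists>\<xi>\<in>subdifferential (Reg 1) xd. (\<exists>\<omega>. \<xi> = adjoint F \<omega>)
            \<and> inj_on F {x. supp x \<subseteq> {i. \<bar>coord \<xi> i\<bar> = 1}}))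
       \<or> (p < 1 \<and> Sol p F (F xd) 0 = {xd}
            \<and> inj_on F {x. supp x \<subseteq> supp xd})"
  shows "(\<forall>\<^sub>F \<beta> in at_right 0. worst_case_error p F xd \<beta> < \<infinity>)
       \<and> (\<lambda>\<beta>. enn2real (worst_case_error p F xd \<beta>)) \<in> O[at_right 0](\<lambda>\<beta>. \<beta> powr min 1 (1 / p))"
proof -
  have "\<exists>C\<ge>0. \<exists>b>0. \<forall>\<beta> x. 0 < \<beta> \<longrightarrow> \<beta> \<le> b \<longrightarrow> Reg p x \<le> Reg p xd
           \<longrightarrow> norm (F (x - xd)) \<le> 2 * \<beta> \<longrightarrow> norm (x - xd) \<le> C * \<beta> powr min 1 (1 / p)"
    using assms(5)
  proof (elim disjE conjE exE bexE)
    fix \<omega>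
    assume p: "1 < p" and sub: "subdifferential (Reg p) xd = {adjoint F \<omega>}"
      and inj: "inj_on F {x. supp x \<subseteq> supp xd}"
    then have \<xi>: "adjoint F \<omega> \<in> subdifferential (Reg p) xd"
      by simp
    show ?thesis
    \<comment> \<open>Off the support the subgradient vanishes, so \<open>m = 0\<close> is
      admissible.\<close>
    proof (rule subgradient_rate[OF _ _ assms(4) _ order_refl inj \<xi> refl, of 0])
      show "\<bar>coord (adjoint F \<omega>) i * t\<bar> \<le> 0 * \<bar>t\<bar> powr p" if "i \<notin> supp xd" for i t
        using subgradient_coord_zero[OF p \<xi> assms(3) that] by simp
    qed (use p assms in \<open>auto simp: is_sparse_def\<close>)
  next
    fix \<xi> \<omega>
    assume p: "p = 1" and \<xi>: "\<xi> \<in> subdifferential (Reg 1) xd" "\<xi> = adjoint F \<omega>"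
      and inj: "inj_on F {x. supp x \<subseteq> {i. \<bar>coord \<xi> i\<bar> = 1}}"
    define T where "T = {i. \<bar>coord \<xi> i\<bar> = 1}"
    have sub: "coord \<xi> i * t \<le> \<bar>coord xd i + t\<bar> - \<bar>coord xd i\<bar>" for i t
      using subgradient_coord_le[OF \<xi>(1) assms(3), of i t] by simp
    have le_1: "\<bar>coord \<xi> i\<bar> \<le> 1" for i
      using sub[of i 1] sub[of i "-1"] by linarith
    have "supp xd \<subseteq> T"
    proof
      fix i assume "i \<in> supp xd"
      then have nz: "coord xd i \<noteq> 0"
        by (simp add: supp_def)
      \<comment> \<open>The increments \<open>coord xd i\<close> and \<open>- coord xd i\<close>
        give the two inequalities.\<close>
      have "coord \<xi> i * coord xd i = \<bar>coord xd i\<bar>"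
        using sub[of i "coord xd i"] sub[of i "- coord xd i"] by simp
      then have "\<bar>coord \<xi> i\<bar> * \<bar>coord xd i\<bar> = \<bar>coord xd i\<bar>"
        by (metis abs_abs abs_mult)
      with nz show "i \<in> T"
        by (simp add: T_def)
    qed
    \<comment> \<open>Square summability: \<open>n\<close> indices of modulus at least 1/2
      contribute at least \<open>n / 4\<close> to the squared norm. Any level strictly between 0 and
      1 would do.\<close>
    have fin: "finite {i. 1 / 2 \<le> \<bar>coord \<xi> i\<bar>}"
    proof (rule ccontr)
      assume inf: "infinite {i. 1 / 2 \<le> \<bar>coord \<xi> i\<bar>}"
      obtain n :: nat where n: "4 * (norm \<xi>)\<^sup>2 < real n"
        using reals_Archimedean2 by blast
      obtain A where A: "A \<subseteq> {i. 1 / 2 \<le> \<bar>coord \<xi> i\<bar>}" "card A = n" "finite A"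
        using infinite_arbitrarily_large[OF inf] by blast
      have "(1 / 2)\<^sup>2 \<le> (coord \<xi> i)\<^sup>2" if "i \<in> A" for i
        using A(1) that by (subst abs_le_square_iff[symmetric]) auto
      then have "(\<Sum>i\<in>A. (1 / 2)\<^sup>2) \<le> (\<Sum>i\<in>A. (coord \<xi> i)\<^sup>2)"
        by (rule sum_mono)
      with sum_coord_sq_le[OF A(3), of \<xi>] n A(2) show False
        by (simp add: power2_eq_square)
    qed
    then have "finite T"
      by (rule finite_subset[rotated]) (auto simp: T_def)
    \<comment> \<open>Only finitely many moduli off \<open>T\<close> reach 1/2, so their maximum
      stays below 1. Including 1/2 keeps \<open>S\<close> nonempty and covers the other
      indices.\<close>
    define S where "S = insert (1 / 2) ((\<lambda>i. \<bar>coord \<xi> i\<bar>) ` ({i. 1 / 2 \<le> \<bar>coord \<xi> i\<bar>} - T))"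
    define m where "m = Max S"
    have S: "finite S"
      using fin by (simp add: S_def)
    have "m \<in> S"
      unfolding m_def using S by (intro Max_in) (auto simp: S_def)
    then have m1: "m < 1"
      using le_1 by (auto simp: S_def T_def less_le)
    have m_ge: "1 / 2 \<le> m"
      unfolding m_def using S by (intro Max_ge) (auto simp: S_def)
    have coord_le_m: "\<bar>coord \<xi> i\<bar> \<le> m" if "i \<notin> T" for i
    proof (cases "1 / 2 \<le> \<bar>coord \<xi> i\<bar>")
      case True
      then show ?thesis
        unfolding m_def using S that by (intro Max_ge) (auto simp: S_def)
    qed (use m_ge in linarith)
    show ?thesis
      unfolding p
    proof (rule subgradient_rate[OF _ _ assms(4) \<open>finite T\<close> \<open>supp xd \<subseteq> T\<close> inj[folded T_def] \<xi> _ m1])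
      show "\<bar>coord \<xi> i * t\<bar> \<le> m * \<bar>t\<bar> powr 1" if "i \<notin> T" for i t
        using mult_right_mono[OF coord_le_m[OF that], of "\<bar>t\<bar>"] by (simp add: abs_mult)
    qed (use m_ge in auto)
  next
    assume "p < 1" "Sol p F (F xd) 0 = {xd}" "inj_on F {x. supp x \<subseteq> supp xd}"
    then show ?thesis
      by (intro unique_minimizer_rate assms)
  qed
  then obtain C b where "0 \<le> C" "0 < b" and "\<And>\<beta> x. \<lbrakk>0 < \<beta>; \<beta> \<le> b; Reg p x \<le> Reg p xd;
      norm (F (x - xd)) \<le> 2 * \<beta>\<rbrakk> \<Longrightarrow> norm (x - xd) \<le> C * \<beta> powr min 1 (1 / p)"
    by blast
  then show ?thesis
    by (rule worst_case_error_bigo[OF bounded_linear.linear[OF assms(4)]])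
qed

end
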